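(* Let $X_1,\dots,X_k$ ($k\ge 2$) be i.i.d., positive and bounded random variables having an absolutely continuous (with respect to Lebesgue measure) distribution function $F(x)$, where $F$ belongs to the class $\mathcal F$. Then the equality in law of $X_1$ and $X_{(k,k)}/X_{(k-1,k)}$ takes place if and only if $X_1$ has some distribution function from the family $\mathcal P$.
   Context: $\mathcal P$ denotes the family of Pareto distributions, with distribution functions $F(x)=1-x^{-\lambda}$, $x\ge 1$, $\lambda>0$. A distribution function $F$ is said to belong to the class $\mathcal F$ if for all $x_1,x_2$: either $F(x_1x_2)\le F(x_1)F(x_2)$ or $F(x_1x_2)\ge F(x_1)F(x_2)$. $X_{(1,k)}\le X_{(2,k)}\le\dots\le X_{(k,k)}$ denote the order statistics of the sample $X_1,\dots,X_k$. *)

theory Defs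
  imports "HOL-Probability.Probability"
begin

definition pareto_cdf :: "real \<Rightarrow> real \<Rightarrow> real" where
  "pareto_cdf l x = (if 1 \<le> x then 1 - x powr (- l) else 0)"

definition pareto_family :: "(real \<Rightarrow> real) set" where
  "pareto_family = {pareto_cdf l | l. 0 < l}"

text \<open>The direction of the inequality is the same for all pairs; with the choice made
  separately for each pair, every function would qualify. The arguments range over the positive
  half-line, where the distribution function of a positive random variable is not identically 0.
  Over all reals the first alternative could never hold: for two negative arguments the
  right-hand side vanishes.\<close>

definition mult_class :: "(real \<Rightarrow> real) set" where
  "mult_class = {F. (\<forall>x1>0. \<forall>x2>0. F (x1 * x2) \<le> F x1 * F x2) \<or>
                    (\<forall>x1>0. \<forall>x2>0. F (x1 * x2) \<ge> F x1 * F x2)}"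

text \<open>Boundedness of a positive random variable on the scale of the multiplicative half-line:
  bounded above, or bounded away from 0. Ordinary (two-sided) boundedness is an instance of the
  first alternative, see below. It would exclude every Pareto law, since these have
  unbounded support; the second alternative admits them.\<close>

definition bounded_rv :: "'a measure \<Rightarrow> ('a \<Rightarrow> real) \<Rightarrow> bool" where
  "bounded_rv M Y \<longleftrightarrow> (\<exists>b. AE \<omega> in M. Y \<omega> \<le> b) \<or> (\<exists>a>0. AE \<omega> in M. a \<le> Y \<omega>)"

lemma bounded_rvI: "AE \<omega> in M. \<bar>Y \<omega>\<bar> \<le> b \<Longrightarrow> bounded_rv M Y"
  unfolding bounded_rv_def by (rule disjI1, rule exI[of _ b]) (auto elim: eventually_mono)

text \<open>\<open>order_stat X k j\<close> is the \<open>j\<close>-th smallest of \<open>X 1, \<dots>, X k\<close>, for \<open>1 \<le> j \<le> k\<close>.\<close>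

definition order_stat :: "(nat \<Rightarrow> 'a \<Rightarrow> real) \<Rightarrow> nat \<Rightarrow> nat \<Rightarrow> 'a \<Rightarrow> real" where
  "order_stat X k j \<omega> = sort (map (\<lambda>i. X i \<omega>) [1..<Suc k]) ! (j - 1)"

end

theory Submission
  imports Defs "HOL-Combinatorics.List_Permutation" "HOL-Real_Asymp.Real_Asymp"
begin

text \<open>For a positive atomless sample the ratio \<open>R\<close> of the two largest values exceeds \<open>r \<ge> 1\<close> exactly
if one observation exceeds \<open>r\<close> times the maximum of the others. The \<open>k\<close> events of this kind are
disjoint and equally likely, so with \<open>F\<close> the distribution function of an observation and \<open>N\<close> the
law of the maximum of \<open>k - 1\<close> of them (\<open>cdf_R\<close>)

  \<open>P (R > r) = k * (\<integral>y. 1 - F (r * y) \<partial>N)\<close>.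

For \<open>r = 1\<close> both sides are \<open>1\<close> (\<open>total_mass\<close>), since ties have probability \<open>0\<close>. If the tail \<open>1 - F\<close>
is a negative power on \<open>[1, \<infinity>)\<close>, it factors out of the integral and \<open>R\<close> has the tail \<open>1 - F\<close> again.

Conversely, if \<open>R\<close> is distributed like an observation, then the sample lies in \<open>[1, \<infinity>)\<close>, and
\<open>G x = 1 - F (exp x)\<close> satisfies, for \<open>x \<ge> 0\<close>,

  \<open>G x = k * E (G (x + Y))\<close>

where \<open>Y > 0\<close> is the logarithm of the maximum of \<open>k - 1\<close> observations. The solutions of such an
integrated Cauchy equation are exponentials (\<open>integrated_Cauchy_equation\<close>). To see this, choose
\<open>\<alpha> > 0\<close> with \<open>k * E (exp (- \<alpha> Y)) = 1\<close>, which is possible as \<open>k > 1\<close>. Then \<open>H x = exp (\<alpha> x) * G x\<close> is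
harmonic for the random walk whose step law has density \<open>k * exp (- \<alpha> y)\<close> with respect to the law of \<open>Y\<close>.
A conserved quantity of this walk and the monotonicity of \<open>G\<close> show that \<open>H\<close> is bounded
(\<open>harmonic_slow_growth_bounded\<close>). The one-step variance of a bounded harmonic function vanishes
(\<open>harmonic_bounded_invariant\<close>), so almost every step is a period of \<open>H\<close>, and as the steps have no atoms the continuous
function \<open>H\<close> is constant (\<open>harmonic_bounded_constant\<close>). Hence \<open>G\<close> is exponential on \<open>[0, \<infinity>)\<close>, which says
that \<open>F\<close> is a Pareto distribution function.\<close>

section \<open>Bounded harmonic functions on the half-line\<close>

text \<open>The one-step variance \<open>V x\<close> of \<open>H\<close> along the random walk with step law \<open>S\<close> is the drift of
\<open>H\<^sup>2\<close>, and it is itself subharmonic, being an average of squares of the harmonic functions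
\<open>x \<mapsto> H (x + z) - H x\<close>. So from any starting point each of \<open>n\<close> steps raises the mean of
\<open>H\<^sup>2\<close> by at least \<open>V x\<close>. Since \<open>H\<^sup>2\<close> is bounded, \<open>V x = 0\<close>. This is the argument behind
the Choquet-Deny theorem, here on the half-line.\<close>

lemma harmonic_bounded_invariant:
  fixes S :: "real measure" and H :: "real \<Rightarrow> real"
  assumes "prob_space S" and sets_S[measurable_cong]: "sets S = sets borel"
    and nonneg: "AE y in S. 0 \<le> y"
    and meas[measurable]: "H \<in> borel_measurable borel"
    and bound: "\<And>x. \<bar>H x\<bar> \<le> B"
    and harmonic: "\<And>x. 0 \<le> x \<Longrightarrow> H x = (\<integral>y. H (x + y) \<partial>S)"
    and "0 \<le> x"
  shows "AE y in S. H (x + y) = H x"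
proof -
  interpret prob_space S by fact
  interpret P: pair_prob_space S S ..
  have B0: "0 \<le> B" using bound[of 0] by linarith
  define V where "V x = (\<integral>y. (H (x + y) - H x)\<^sup>2 \<partial>S)" for x
  have sq_bound: "(H a - H b)\<^sup>2 \<le> (2 * B)\<^sup>2" for a b
    using bound[of a] bound[of b] by (intro power2_le_iff_abs_le[THEN iffD2]) auto
  have int_H: "integrable S (\<lambda>y. H (x + y))" for x
    by (rule integrable_const_bound[of _ B]) (use bound in auto)
  have int_H2: "integrable S (\<lambda>y. (H (x + y))\<^sup>2)" for x
    by (rule integrable_const_bound[of _ "B\<^sup>2"])
       (use bound in \<open>auto intro!: power2_le_iff_abs_le[THEN iffD2] simp: B0\<close>)
  have int_D: "integrable S (\<lambda>y. (H (x + y) - H x)\<^sup>2)" for x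
    by (rule integrable_const_bound[of _ "(2 * B)\<^sup>2"]) (use sq_bound in auto)
  have V_meas[measurable]: "V \<in> borel_measurable borel"
    unfolding V_def by measurable
  have V0: "0 \<le> V x" for x unfolding V_def by simp
  have V_le: "V x \<le> (2 * B)\<^sup>2" for x
    unfolding V_def by (rule integral_le_const[OF int_D]) (use sq_bound in auto)
  have int_V: "integrable S (\<lambda>y. V (x + y))" for x
    by (rule integrable_const_bound[of _ "(2 * B)\<^sup>2"]) (use V_le V0 in auto)
  have second_moment: "(\<integral>y. (H (x + y))\<^sup>2 \<partial>S) = V x + (H x)\<^sup>2" if "0 \<le> x" for x
  proof -
    have "V x = (\<integral>y. (H (x + y))\<^sup>2 - 2 * H x * H (x + y) + (H x)\<^sup>2 \<partial>S)"
      unfolding V_def by (intro Bochner_Integration.integral_cong) (auto simp: power2_eq_square algebra_simps)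
    also have "\<dots> = (\<integral>y. (H (x + y))\<^sup>2 \<partial>S) - 2 * H x * (\<integral>y. H (x + y) \<partial>S) + (H x)\<^sup>2"
      by (simp add: int_H int_H2 prob_space)
    also have "\<dots> = (\<integral>y. (H (x + y))\<^sup>2 \<partial>S) - (H x)\<^sup>2"
      using harmonic[OF that] by (simp add: power2_eq_square)
    finally show ?thesis by simp
  qed
  \<comment> \<open>Jensen under the outer integral, then an exchange of the two steps \<open>y\<close> and \<open>z\<close>.\<close>
  have V_sub: "V x \<le> (\<integral>y. V (x + y) \<partial>S)" if "0 \<le> x" for x
  proof -
    have "(H (x + z) - H x)\<^sup>2 \<le> (\<integral>y. (H (x + y + z) - H (x + y))\<^sup>2 \<partial>S)" if "0 \<le> z" for z
    proof -
      have i1: "integrable S (\<lambda>y. H (x + y + z))"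
        using int_H[of "x + z"] by (simp add: ac_simps)
      have "H (x + z) - H x = (\<integral>y. H (x + y + z) - H (x + y) \<partial>S)"
        using harmonic[of "x + z"] harmonic[of x] \<open>0 \<le> x\<close> \<open>0 \<le> z\<close> i1 int_H[of x]
        by (simp add: ac_simps)
      moreover have "integrable S (\<lambda>y. (H (x + y + z) - H (x + y))\<^sup>2)"
        by (rule integrable_const_bound[of _ "(2 * B)\<^sup>2"]) (use sq_bound in auto)
      ultimately show ?thesis
        using jensens_inequality[where X = "\<lambda>y. H (x + y + z) - H (x + y)" and I = UNIV and q = "\<lambda>t. t\<^sup>2"]
          i1 int_H[of x] convex_power2
        by simp
    qed
    then have "V x \<le> (\<integral>z. \<integral>y. (H (x + y + z) - H (x + y))\<^sup>2 \<partial>S \<partial>S)"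
      unfolding V_def
      by (intro integral_mono_AE int_D P.integrable_fst P.integrable_const_bound[of _ "(2 * B)\<^sup>2"])
         (use nonneg sq_bound in auto)
    also have "\<dots> = (\<integral>y. V (x + y) \<partial>S)"
      unfolding V_def
      by (intro P.Fubini_integral P.integrable_const_bound[of _ "(2 * B)\<^sup>2"])
         (use sq_bound in auto)
    finally show ?thesis .
  qed
  \<comment> \<open>One more step adds another \<open>V x\<close>: integrate the claim at \<open>x + y\<close> against \<open>S\<close>.\<close>
  have accumulate: "real n * V x + (H x)\<^sup>2 \<le> B\<^sup>2" if "0 \<le> x" for n x
    using that
  proof (induction n arbitrary: x)
    case 0
    then show ?case using bound[of x] by (auto intro!: power2_le_iff_abs_le[THEN iffD2] simp: B0)
  next
    case (Suc n)
    have "(\<integral>y. real n * V (x + y) + (H (x + y))\<^sup>2 \<partial>S) \<le> B\<^sup>2"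
      by (rule integral_le_const) (use nonneg Suc in \<open>auto intro!: int_V int_H2\<close>)
    then have "real n * (\<integral>y. V (x + y) \<partial>S) + V x + (H x)\<^sup>2 \<le> B\<^sup>2"
      using second_moment[OF \<open>0 \<le> x\<close>] by (simp add: int_V int_H2)
    moreover have "real n * V x \<le> real n * (\<integral>y. V (x + y) \<partial>S)"
      using V_sub[OF \<open>0 \<le> x\<close>] by (intro mult_left_mono) auto
    ultimately show ?case by (simp add: algebra_simps)
  qed
  have "V x = 0"
  proof (rule ccontr)
    assume "V x \<noteq> 0"
    then have "0 < V x" using V0[of x] by simp
    then obtain n where "B\<^sup>2 < real n * V x" using reals_Archimedean3 by blast
    then show False using accumulate[OF \<open>0 \<le> x\<close>, of n] zero_le_power2[of "H x"] by linarith
  qed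
  then have "AE y in S. (H (x + y) - H x)\<^sup>2 = 0"
    unfolding V_def using integral_nonneg_eq_0_iff_AE[OF int_D] by simp
  then show ?thesis by eventually_elim simp
qed

text \<open>By the previous lemma almost every step is a period of \<open>H\<close> on the half-line. The periods are closed
under differences, so they are either separated and thus countably many, which an atomless law
cannot charge, or they contain arbitrarily small elements, and then continuity forces \<open>H\<close> to be constant.\<close>

lemma harmonic_bounded_constant:
  fixes S :: "real measure" and H :: "real \<Rightarrow> real"
  assumes S: "prob_space S" and sets_S[measurable_cong]: "sets S = sets borel"
    and nonneg: "AE y in S. 0 \<le> y"
    and atomless: "\<And>a. measure S {a} = 0"
    and cont: "continuous_on UNIV H"
    and bound: "\<And>x. \<bar>H x\<bar> \<le> B"
    and harmonic: "\<And>x. 0 \<le> x \<Longrightarrow> H x = (\<integral>y. H (x + y) \<partial>S)"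
    and "0 \<le> x"
  shows "H x = H 0"
proof -
  interpret prob_space S by fact
  have meas: "H \<in> borel_measurable borel"
    using cont by (rule borel_measurable_continuous_onI)
  define T where "T = {y. 0 \<le> y \<and> (\<forall>x\<ge>0. H (x + y) = H x)}"
  have isc: "isCont H a" for a using cont by (simp add: continuous_on_eq_continuous_at)
  \<comment> \<open>For each rational \<open>x\<close> almost every step preserves \<open>H x\<close>; continuity extends this to all \<open>x\<close> off one null set.\<close>
  have AE_T: "AE y in S. y \<in> T"
  proof -
    have "AE y in S. \<forall>q\<in>\<rat> \<inter> {0..}. H (q + y) = H q"
      by (intro AE_ball_countable')
         (auto intro!: harmonic_bounded_invariant[OF S sets_S nonneg meas bound harmonic] countable_rat)
    with nonneg show ?thesis
    proof eventually_elim
      case (elim y)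
      have "H (x + y) = H x" if "0 \<le> x" for x
      proof -
        have "\<exists>q. (\<forall>n. q n \<in> \<rat> \<inter> {0..}) \<and> q \<longlonglongrightarrow> x"
        proof -
          have "\<exists>q\<in>\<rat>. x < q \<and> q < x + inverse (Suc n)" for n
            by (rule Rats_dense_in_real) simp
          then obtain q where q: "\<And>n. q n \<in> \<rat>" "\<And>n. x < q n" "\<And>n. q n < x + inverse (Suc n)"
            by metis
          have "q \<longlonglongrightarrow> x"
          proof (rule tendsto_sandwich[of "\<lambda>_. x" _ _ "\<lambda>n. x + inverse (Suc n)"])
            show "(\<lambda>n. x + inverse (Suc n)) \<longlonglongrightarrow> x"
              using LIMSEQ_inverse_real_of_nat_add[of x] by simp
          qed (use q in \<open>auto intro!: always_eventually less_imp_le\<close>)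
          then show ?thesis using q order.trans[OF that less_imp_le[OF q(2)]] by (intro exI[of _ q]) auto
        qed
        then obtain q where q: "\<And>n. q n \<in> \<rat> \<inter> {0..}" "q \<longlonglongrightarrow> x" by blast
        have "(\<lambda>n. H (q n)) \<longlonglongrightarrow> H x" using isCont_tendsto_compose[OF isc q(2)] .
        moreover have "(\<lambda>n. H (q n + y)) \<longlonglongrightarrow> H (x + y)"
          by (rule isCont_tendsto_compose[OF isc]) (intro tendsto_intros q(2))
        then have "(\<lambda>n. H (q n)) \<longlonglongrightarrow> H (x + y)" using elim q(1) by simp
        ultimately show ?thesis using LIMSEQ_unique by blast
      qed
      with elim show ?case by (simp add: T_def)
    qed
  qed
  have T_diff: "b - a \<in> T" if "a \<in> T" "b \<in> T" "a \<le> b" for a b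
    unfolding T_def
  proof (clarsimp, intro conjI allI impI)
    show "a \<le> b" by fact
    fix x :: real assume "0 \<le> x"
    then have "H (x + (b - a)) = H (x + (b - a) + a)"
      using that unfolding T_def mem_Collect_eq by (metis add_nonneg_nonneg diff_ge_0_iff_ge)
    also have "x + (b - a) + a = x + b" by simp
    also have "H (x + b) = H x" using that \<open>0 \<le> x\<close> by (simp add: T_def)
    finally show "H (x + (b - a)) = H x" .
  qed
  have small_period: "\<exists>y\<in>T. 0 < y \<and> y < e" if "0 < e" for e
  proof (rule ccontr)
    assume none: "\<not> (\<exists>y\<in>T. 0 < y \<and> y < e)"
    \<comment> \<open>Periods at mutual distance at least \<open>e\<close> are countably many.\<close>
    have "inj_on (\<lambda>y. \<lfloor>y / e\<rfloor>) T"
    proof (rule linorder_inj_onI)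
      fix a b assume ab: "a < b" "a \<in> T" "b \<in> T"
      then have "e \<le> b - a" using none T_diff[of a b] by fastforce
      then have "a / e + 1 \<le> b / e"
        using \<open>0 < e\<close> divide_right_mono[of "a + e" b e] by (simp add: add_divide_distrib)
      then have "\<lfloor>a / e\<rfloor> + 1 \<le> \<lfloor>b / e\<rfloor>" using floor_mono[of "a / e + 1" "b / e"] by simp
      then show "\<lfloor>a / e\<rfloor> \<noteq> \<lfloor>b / e\<rfloor>" by simp
    qed auto
    then have "countable T" by (rule countableI')
    moreover have "emeasure S {y} = 0" for y using atomless by (simp add: emeasure_eq_measure)
    ultimately have "T \<in> null_sets S"
      by (subst UN_singleton[symmetric], intro null_sets_UN') auto
    then have "AE y in S. y \<notin> T" by (rule AE_not_in)
    with AE_T have "AE y in S. False" by eventually_elim simp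
    then show False by simp
  qed
  have multiples: "H (real n * y) = H 0" if "y \<in> T" for n y
  proof (induction n)
    case (Suc n)
    have "H (real (Suc n) * y) = H (real n * y + y)" by (simp add: algebra_simps)
    also have "\<dots> = H (real n * y)" using that by (simp add: T_def)
    finally show ?case using Suc by simp
  qed simp
  show ?thesis
  proof (rule ccontr)
    assume "H x \<noteq> H 0"
    then obtain d where d: "0 < d" "\<And>z. dist z x < d \<Longrightarrow> dist (H z) (H x) < dist (H 0) (H x)"
      using isc[of x] unfolding continuous_at_eps_delta by (metis zero_less_dist_iff)
    obtain y where y: "y \<in> T" "0 < y" "y < d" using small_period[OF d(1)] by blast
    define n where "n = nat \<lfloor>x / y\<rfloor>"
    have "real n \<le> x / y" "x / y < real n + 1"
      unfolding n_def using \<open>0 \<le> x\<close> y(2) by auto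
    then have "real n * y \<le> x" "x < real n * y + y"
      using y(2) by (simp_all add: field_simps)
    then have "dist (real n * y) x < d" using y(3) by (simp add: dist_real_def)
    then show False using d(2)[of "real n * y"] multiples[OF y(1), of n] by simp
  qed
qed

section \<open>A conserved quantity bounds harmonic functions\<close>

lemma nn_integral_Icc_append:
  fixes h :: "real \<Rightarrow> ennreal"
  assumes [measurable]: "h \<in> borel_measurable borel" and "0 \<le> a" "0 \<le> b"
  shows "(\<integral>\<^sup>+t. h t * indicator {0..a + b} t \<partial>lborel) =
    (\<integral>\<^sup>+t. h t * indicator {0..a} t \<partial>lborel) + (\<integral>\<^sup>+t. h (a + t) * indicator {0..b} t \<partial>lborel)"
proof -
  have "(\<integral>\<^sup>+t. h t * indicator {0..a + b} t \<partial>lborel) =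
    (\<integral>\<^sup>+t. h t * indicator {0..a} t + h t * indicator {a..a + b} t \<partial>lborel)"
  proof (rule nn_integral_cong_AE)
    show "AE t in lborel. h t * indicator {0..a + b} t =
        h t * indicator {0..a} t + h t * indicator {a..a + b} t"
      using AE_lborel_singleton[of a]
      by eventually_elim (use assms(2,3) in \<open>auto split: split_indicator\<close>)
  qed
  also have "\<dots> = (\<integral>\<^sup>+t. h t * indicator {0..a} t \<partial>lborel) + (\<integral>\<^sup>+t. h t * indicator {a..a + b} t \<partial>lborel)"
    by (rule nn_integral_add) auto
  also have "(\<integral>\<^sup>+t. h t * indicator {a..a + b} t \<partial>lborel) =
      (\<integral>\<^sup>+t. h (a + t) * indicator {a..a + b} (a + t) \<partial>lborel)"
    using nn_integral_real_affine[of "\<lambda>t. h t * indicator {a..a + b} t" 1 a] by simp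
  also have "\<dots> = (\<integral>\<^sup>+t. h (a + t) * indicator {0..b} t \<partial>lborel)"
    by (intro nn_integral_cong) (auto split: split_indicator)
  finally show ?thesis .
qed

lemma borel_measurable_nn_integral_Icc:
  fixes h :: "real \<Rightarrow> ennreal"
  assumes [measurable]: "h \<in> borel_measurable borel"
  shows "(\<lambda>y. \<integral>\<^sup>+t. h t * indicator {0..y} t \<partial>lborel) \<in> borel_measurable borel"
proof -
  have "indicator {0..y} t = (if 0 \<le> t \<and> t \<le> y then 1 else 0 :: ennreal)" for y t :: real
    by (simp add: indicator_def)
  then show ?thesis by simp
qed

text \<open>For a harmonic \<open>H\<close> with primitive \<open>\<Phi> x\<close> (the integral of \<open>H\<close> over \<open>[0, x]\<close>), the mean of
\<open>\<Phi> (x + y) - \<Phi> x\<close> over a step \<open>y\<close> does not depend on \<open>x\<close>: its derivative in \<open>x\<close> is the mean of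
\<open>H (x + y)\<close> minus \<open>H x\<close>. The growth condition makes this conserved quantity finite. It also
excludes narrow peaks: a positive multiple of \<open>H x\<close> is a lower bound for \<open>H\<close> on
\<open>[x - \<delta>, x]\<close>, and a step exceeds \<open>\<delta>\<close> with positive probability, so a large value of \<open>H x\<close>
would exceed the conserved quantity.\<close>

lemma harmonic_slow_growth_bounded:
  fixes S :: "real measure" and H :: "real \<Rightarrow> real"
  assumes "prob_space S" and sets_S[measurable_cong]: "sets S = sets borel"
    and pos: "AE y in S. 0 < y"
    and meas[measurable]: "H \<in> borel_measurable borel"
    and nonneg: "\<And>x. 0 \<le> H x"
    and "0 < \<alpha>"
    and growth: "\<And>s t. 0 \<le> s \<Longrightarrow> s \<le> t \<Longrightarrow> H t \<le> exp (\<alpha> * (t - s)) * H s"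
    and expint: "integrable S (\<lambda>y. exp (\<alpha> * y))"
    and harmonic: "\<And>x. 0 \<le> x \<Longrightarrow> H x = (\<integral>y. H (x + y) \<partial>S)"
  obtains B where "\<And>x. 0 \<le> x \<Longrightarrow> H x \<le> B"
proof -
  interpret prob_space S by fact
  interpret P: pair_sigma_finite lborel S ..
  define \<Phi> where "\<Phi> y = (\<integral>\<^sup>+t. ennreal (H t) * indicator {0..y} t \<partial>lborel)" for y
  have [measurable]: "\<Phi> \<in> borel_measurable borel"
    unfolding \<Phi>_def by (rule borel_measurable_nn_integral_Icc) measurable
  have \<Phi>_le: "\<Phi> y \<le> ennreal (H 0 / \<alpha> * exp (\<alpha> * y))" if "0 \<le> y" for y
  proof -
    have "\<Phi> y \<le> (\<integral>\<^sup>+t. ennreal (H 0 * exp (\<alpha> * t)) * indicator {0..y} t \<partial>lborel)"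
      unfolding \<Phi>_def
      by (intro nn_integral_mono) (use growth[of 0] in \<open>auto split: split_indicator intro!: ennreal_leI simp: mult.commute\<close>)
    also have "\<dots> = ennreal (H 0 / \<alpha> * exp (\<alpha> * y) - H 0 / \<alpha> * exp (\<alpha> * 0))"
      using \<open>0 < \<alpha>\<close> nonneg that
      by (intro nn_integral_FTC_Icc) (auto intro!: derivative_eq_intros)
    also have "\<dots> \<le> ennreal (H 0 / \<alpha> * exp (\<alpha> * y))"
      using \<open>0 < \<alpha>\<close> nonneg[of 0] by (intro ennreal_leI) auto
    finally show ?thesis .
  qed
  define C where "C = (\<integral>\<^sup>+y. \<Phi> y \<partial>S)"
  have "C \<le> (\<integral>\<^sup>+y. ennreal (H 0 / \<alpha> * exp (\<alpha> * y)) \<partial>S)"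
    unfolding C_def
  proof (rule nn_integral_mono_AE)
    show "AE y in S. \<Phi> y \<le> ennreal (H 0 / \<alpha> * exp (\<alpha> * y))"
      using pos by eventually_elim (rule \<Phi>_le, simp)
  qed
  also have "\<dots> = ennreal (\<integral>y. H 0 / \<alpha> * exp (\<alpha> * y) \<partial>S)"
    using expint nonneg[of 0] \<open>0 < \<alpha>\<close> by (intro nn_integral_eq_integral) auto
  finally have C_fin: "C < \<infinity>" using le_less_trans by fastforce
  have nn_harmonic: "(\<integral>\<^sup>+y. ennreal (H (x + y)) \<partial>S) = ennreal (H x)" if "0 \<le> x" for x
  proof -
    have "integrable S (\<lambda>y. H (x + y))"
    proof (rule Bochner_Integration.integrable_bound)
      show "integrable S (\<lambda>y. H 0 * exp (\<alpha> * x) * exp (\<alpha> * y))" using expint by simp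
      show "AE y in S. norm (H (x + y)) \<le> norm (H 0 * exp (\<alpha> * x) * exp (\<alpha> * y))"
        using pos
      proof eventually_elim
        case (elim y)
        then show ?case using growth[of 0 "x + y"] that nonneg
          by (simp add: distrib_left exp_add mult_ac)
      qed
    qed simp
    then show ?thesis using nonneg harmonic[OF that] by (simp add: nn_integral_eq_integral)
  qed
  \<comment> \<open>Both orders of splitting \<open>[0, x + y]\<close> are used: after \<open>x\<close>, and after \<open>y\<close>, where harmonicity applies.\<close>
  have conserved: "(\<integral>\<^sup>+y. (\<integral>\<^sup>+t. ennreal (H (x + t)) * indicator {0..y} t \<partial>lborel) \<partial>S) = C" if "0 \<le> x" for x
  proof -
    have [measurable]: "(\<lambda>y. \<integral>\<^sup>+t. ennreal (H (x + t)) * indicator {0..y} t \<partial>lborel) \<in> borel_measurable borel"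
      by (rule borel_measurable_nn_integral_Icc) measurable
    have "\<Phi> x + (\<integral>\<^sup>+y. (\<integral>\<^sup>+t. ennreal (H (x + t)) * indicator {0..y} t \<partial>lborel) \<partial>S) =
        (\<integral>\<^sup>+y. \<Phi> x + (\<integral>\<^sup>+t. ennreal (H (x + t)) * indicator {0..y} t \<partial>lborel) \<partial>S)"
      by (subst nn_integral_add) (auto simp: emeasure_space_1)
    also have "\<dots> = (\<integral>\<^sup>+y. \<Phi> (x + y) \<partial>S)"
      using pos that
      by (intro nn_integral_cong_AE) (auto elim!: eventually_mono simp: \<Phi>_def nn_integral_Icc_append)
    also have "\<dots> = (\<integral>\<^sup>+y. \<Phi> y + (\<integral>\<^sup>+t. ennreal (H (y + t)) * indicator {0..x} t \<partial>lborel) \<partial>S)"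
      using pos that
      by (intro nn_integral_cong_AE)
         (auto elim!: eventually_mono simp: \<Phi>_def nn_integral_Icc_append add.commute[of x])
    also have "\<dots> = C + (\<integral>\<^sup>+y. (\<integral>\<^sup>+t. ennreal (H (y + t)) * indicator {0..x} t \<partial>lborel) \<partial>S)"
      unfolding C_def by (rule nn_integral_add) auto
    also have "(\<integral>\<^sup>+y. (\<integral>\<^sup>+t. ennreal (H (y + t)) * indicator {0..x} t \<partial>lborel) \<partial>S) =
        (\<integral>\<^sup>+t. (\<integral>\<^sup>+y. ennreal (H (y + t)) * indicator {0..x} t \<partial>S) \<partial>lborel)"
      by (rule P.Fubini') measurable
    also have "\<dots> = \<Phi> x"
      unfolding \<Phi>_def
      by (intro nn_integral_cong) (auto split: split_indicator simp: nn_harmonic add.commute)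
    finally show ?thesis
      using \<Phi>_le[OF that] by (metis add.commute ennreal_add_left_cancel ennreal_less_top infinity_ennreal_def le_less_trans less_irrefl)
  qed
  obtain \<delta> where \<delta>: "0 < \<delta>" "0 < measure S {\<delta>..}"
  proof (rule ccontr)
    assume *: "\<not> thesis"
    have "measure S {inverse (real (Suc n))..} = 0" for n
      using that[of "inverse (real (Suc n))"] * by (auto simp: zero_less_measure_iff)
    then have "AE y in S. y \<notin> {inverse (real (Suc n))..}" for n
      by (intro AE_not_in) (auto simp: null_sets_def emeasure_eq_measure)
    then have "AE y in S. \<forall>n. y \<notin> {inverse (real (Suc n))..}"
      by (simp add: AE_all_countable)
    with pos have "AE y in S. False"
    proof eventually_elim
      case (elim y)
      obtain n where "inverse (real (Suc n)) < y" using reals_Archimedean elim(1) by blast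
      then show ?case using elim(2) by (auto intro: less_imp_le)
    qed
    then show False by simp
  qed
  have "H x \<le> max (exp (\<alpha> * \<delta>) * H 0) (exp (\<alpha> * \<delta>) * enn2real C / (\<delta> * measure S {\<delta>..}))" if "0 \<le> x" for x
  proof (cases "x \<le> \<delta>")
    case True
    then have "H x \<le> exp (\<alpha> * x) * H 0" using growth[of 0 x] that by simp
    also have "\<dots> \<le> exp (\<alpha> * \<delta>) * H 0"
      using True \<open>0 < \<alpha>\<close> nonneg by (intro mult_right_mono) auto
    finally show ?thesis by simp
  next
    case False
    define z where "z = x - \<delta>"
    define m where "m = exp (- (\<alpha> * \<delta>)) * H x"
    have m0: "0 \<le> m" using nonneg by (simp add: m_def)
    have low: "m \<le> H (z + t)" if "0 \<le> t" "t \<le> \<delta>" for t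
    proof -
      have "H x \<le> exp (\<alpha> * (\<delta> - t)) * H (z + t)"
        using growth[of "z + t" x] that False by (simp add: z_def algebra_simps)
      also have "\<dots> \<le> exp (\<alpha> * \<delta>) * H (z + t)"
        using that \<open>0 < \<alpha>\<close> nonneg by (intro mult_right_mono) auto
      finally show ?thesis by (simp add: m_def exp_minus field_simps)
    qed
    have "ennreal (m * (\<delta> * measure S {\<delta>..})) = (\<integral>\<^sup>+y. ennreal (m * \<delta>) * indicator {\<delta>..} y \<partial>S)"
      using m0 \<delta> by (simp add: nn_integral_cmult emeasure_eq_measure ennreal_mult'' mult.assoc sets_S)
    also have "\<dots> = (\<integral>\<^sup>+y. (\<integral>\<^sup>+t. ennreal m * indicator {0..\<delta>} t \<partial>lborel) * indicator {\<delta>..} y \<partial>S)"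
      using m0 \<delta> by (simp add: nn_integral_cmult ennreal_mult'')
    also have "\<dots> \<le> (\<integral>\<^sup>+y. (\<integral>\<^sup>+t. ennreal (H (z + t)) * indicator {0..y} t \<partial>lborel) \<partial>S)"
      using low by (intro nn_integral_mono)
        (auto split: split_indicator intro!: nn_integral_mono ennreal_leI)
    also have "\<dots> = C" using False by (intro conserved) (simp add: z_def)
    finally have "m * (\<delta> * measure S {\<delta>..}) \<le> enn2real C"
      using C_fin m0 \<delta> by (metis enn2real_ennreal enn2real_mono infinity_ennreal_def mult_nonneg_nonneg measure_nonneg less_imp_le)
    then have "m \<le> enn2real C / (\<delta> * measure S {\<delta>..})" using \<delta> by (simp add: pos_le_divide_eq)
    then have "exp (\<alpha> * \<delta>) * m \<le> exp (\<alpha> * \<delta>) * (enn2real C / (\<delta> * measure S {\<delta>..}))"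
      by (intro mult_left_mono) auto
    also have "exp (\<alpha> * \<delta>) * m = H x" by (simp add: m_def exp_minus)
    finally show ?thesis by simp
  qed
  then show thesis by (rule that)
qed

section \<open>The integrated Cauchy equation\<close>

text \<open>The Laplace transform of \<open>N\<close> decreases continuously from \<open>1\<close> to \<open>0\<close>, so it takes the value \<open>1 / k\<close>.\<close>

lemma exponential_tilt_exists:
  fixes N :: "real measure" and k :: real
  assumes "prob_space N" and sets_N[measurable_cong]: "sets N = sets borel"
    and pos: "AE y in N. 0 < y" and "1 < k"
  obtains \<alpha> where "0 < \<alpha>" "k * (\<integral>y. exp (- (\<alpha> * y)) \<partial>N) = 1"
proof -
  interpret prob_space N by fact
  define L where "L a = (\<integral>y. exp (- (a * y)) \<partial>N)" for a
  have L_conv: "(\<lambda>n. L (s n)) \<longlonglongrightarrow> (\<integral>y. g y \<partial>N)"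
    if "\<And>n. 0 \<le> s n" "\<And>y. 0 < y \<Longrightarrow> (\<lambda>n. exp (- (s n * y))) \<longlonglongrightarrow> g y" "g \<in> borel_measurable borel"
    for s :: "nat \<Rightarrow> real" and g
    unfolding L_def
  proof (rule integral_dominated_convergence[where w = "\<lambda>_. 1"])
    show "AE y in N. (\<lambda>n. exp (- (s n * y))) \<longlonglongrightarrow> g y"
      using pos by eventually_elim (rule that)
    show "AE y in N. norm (exp (- (s n * y))) \<le> 1" for n
      using pos by eventually_elim (simp add: that(1))
  qed (use that(3) in auto)
  have cont: "continuous_on {0..} L"
    unfolding continuous_on_sequentially comp_def
  proof (intro allI ballI impI)
    fix s a assume "a \<in> {0..}" and s: "(\<forall>n. s n \<in> {0..}) \<and> s \<longlonglongrightarrow> (a :: real)"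
    show "(\<lambda>n. L (s n)) \<longlonglongrightarrow> L a"
      unfolding L_def[of a] by (rule L_conv) (use s in \<open>auto intro!: tendsto_intros\<close>)
  qed
  have "(\<lambda>n. L (real n)) \<longlonglongrightarrow> (\<integral>y. 0 \<partial>N)"
  proof (rule L_conv)
    fix y :: real assume "0 < y"
    then show "(\<lambda>n. exp (- (real n * y))) \<longlonglongrightarrow> 0" by real_asymp
  qed auto
  then have "eventually (\<lambda>n. L (real n) < 1 / k) sequentially"
    using \<open>1 < k\<close> by (intro order_tendstoD) auto
  then obtain n where "L (real n) < 1 / k" by (auto simp: eventually_sequentially)
  moreover have "1 / k < L 0" using \<open>1 < k\<close> by (simp add: L_def prob_space)
  ultimately obtain \<alpha> where \<alpha>: "0 \<le> \<alpha>" "L \<alpha> = 1 / k"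
    using IVT2'[of L "real n" "1 / k" 0] continuous_on_subset[OF cont, of "{0..real n}"] by auto
  with \<open>1 / k < L 0\<close> have "\<alpha> \<noteq> 0" by auto
  then show thesis using \<alpha> \<open>1 < k\<close> by (intro that[of \<alpha>]) (auto simp: L_def)
qed

text \<open>An instance of the Lau-Rao theorem on the integrated Cauchy functional equation. With the
exponent \<open>\<alpha>\<close> of the previous lemma, the law \<open>S\<close> with density \<open>k * exp (- \<alpha> y)\<close> with respect to \<open>N\<close> is
a probability, and \<open>H x = exp (\<alpha> x) * G x\<close> is harmonic for it. As \<open>G\<close> decreases, \<open>H\<close> grows at most
at the rate \<open>\<alpha>\<close>, so \<open>H\<close> is bounded and therefore constant.\<close>

lemma integrated_Cauchy_equation:
  fixes N :: "real measure" and G :: "real \<Rightarrow> real" and k :: real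
  assumes N: "prob_space N" and sets_N[measurable_cong]: "sets N = sets borel"
    and pos: "AE y in N. 0 < y"
    and atomless: "\<And>a. measure N {a} = 0"
    and "1 < k"
    and cont: "continuous_on UNIV G"
    and decreasing: "antimono G"
    and range: "\<And>x. 0 \<le> G x" "\<And>x. G x \<le> 1" "G 0 = 1"
    and eq: "\<And>x. 0 \<le> x \<Longrightarrow> G x = k * (\<integral>y. G (x + y) \<partial>N)"
  obtains \<alpha> where "0 < \<alpha>" "\<And>x. 0 \<le> x \<Longrightarrow> G x = exp (- (\<alpha> * x))"
proof -
  interpret prob_space N by fact
  obtain \<alpha> where \<alpha>: "0 < \<alpha>" "k * (\<integral>y. exp (- (\<alpha> * y)) \<partial>N) = 1"
    using exponential_tilt_exists[OF N sets_N pos \<open>1 < k\<close>] .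
  define w where "w y = k * exp (- (\<alpha> * y))" for y
  have [measurable]: "w \<in> borel_measurable borel" unfolding w_def by measurable
  have w0: "0 \<le> w y" for y using \<open>1 < k\<close> by (simp add: w_def)
  have int_exp: "integrable N (\<lambda>y. exp (- (\<alpha> * y)))"
    by (rule integrable_const_bound[of _ 1]) (use pos \<alpha> in \<open>auto elim!: eventually_mono\<close>)
  define S where "S = density N (\<lambda>y. ennreal (w y))"
  have sets_S[measurable_cong]: "sets S = sets borel" by (simp add: S_def sets_N)
  have S: "prob_space S"
  proof (rule prob_spaceI)
    have "emeasure S (space S) = (\<integral>\<^sup>+y. ennreal (w y) \<partial>N)"
      by (simp add: S_def emeasure_density cong: nn_integral_cong)
    also have "\<dots> = ennreal (\<integral>y. w y \<partial>N)"
      by (rule nn_integral_eq_integral) (use int_exp w0 in \<open>auto simp: w_def[abs_def]\<close>)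
    also have "(\<integral>y. w y \<partial>N) = 1" using \<alpha>(2) by (simp add: w_def[abs_def])
    finally show "emeasure S (space S) = 1" by simp
  qed
  have pos_S: "AE y in S. 0 < y"
    unfolding S_def using pos by (subst AE_density) auto
  have atomless_S: "measure S {a} = 0" for a
  proof -
    have "{a} \<in> null_sets N" using atomless by (simp add: null_sets_def emeasure_eq_measure sets_N)
    then have "AE y in N. y \<noteq> a" using AE_not_in by fastforce
    then have "AE y in S. y \<notin> {a}" unfolding S_def by (subst AE_density) auto
    then have "emeasure S {a} = 0"
      by (subst (asm) AE_iff_measurable[of "{a}"]) (auto simp: sets_S sets_eq_imp_space_eq[OF sets_S])
    then show ?thesis by (simp add: measure_def)
  qed
  have [measurable]: "G \<in> borel_measurable borel"
    using cont by (rule borel_measurable_continuous_onI)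
  define H where "H x = exp (\<alpha> * x) * G x" for x
  have [measurable]: "H \<in> borel_measurable borel" unfolding H_def by measurable
  have H0: "0 \<le> H x" for x using range by (simp add: H_def)
  have int_S: "(\<integral>y. f y \<partial>S) = (\<integral>y. w y * f y \<partial>N)" if "f \<in> borel_measurable borel" for f :: "real \<Rightarrow> real"
    unfolding S_def using that w0 by (subst integral_density) auto
  have harmonic: "H x = (\<integral>y. H (x + y) \<partial>S)" if "0 \<le> x" for x
  proof -
    have "(\<integral>y. H (x + y) \<partial>S) = (\<integral>y. exp (\<alpha> * x) * (k * G (x + y)) \<partial>N)"
      by (subst int_S) (auto simp: w_def H_def distrib_left exp_add exp_minus field_simps
          intro!: Bochner_Integration.integral_cong)
    also have "\<dots> = exp (\<alpha> * x) * (k * (\<integral>y. G (x + y) \<partial>N))" by simp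
    finally show ?thesis using eq[OF that] by (simp add: H_def)
  qed
  have growth: "H t \<le> exp (\<alpha> * (t - s)) * H s" if "0 \<le> s" "s \<le> t" for s t
  proof -
    have "exp (\<alpha> * (t - s)) * H s = exp (\<alpha> * t) * G s"
      by (simp add: H_def right_diff_distrib exp_diff)
    moreover have "exp (\<alpha> * t) * G t \<le> exp (\<alpha> * t) * G s"
      using antimonoD[OF decreasing that(2)] by simp
    ultimately show ?thesis by (simp only: H_def)
  qed
  have expint: "integrable S (\<lambda>y. exp (\<alpha> * y))"
  proof -
    have "integrable N (\<lambda>y. w y * exp (\<alpha> * y))"
      by (simp add: w_def mult.assoc flip: exp_add)
    then show ?thesis unfolding S_def using w0 by (subst integrable_density) auto
  qed
  obtain B where B: "\<And>x. 0 \<le> x \<Longrightarrow> H x \<le> B"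
    using harmonic_slow_growth_bounded[OF S sets_S pos_S \<open>H \<in> _\<close> H0 \<alpha>(1) growth expint harmonic] by blast
  \<comment> \<open>The bound on \<open>H\<close> holds on the half-line, so \<open>H\<close> is continued by \<open>H 0\<close> to the left of \<open>0\<close>.\<close>
  define K where "K x = H (max 0 x)" for x
  have K_eq: "K x = K 0" if "0 \<le> x" for x
  proof (rule harmonic_bounded_constant[OF S sets_S])
    show "AE y in S. 0 \<le> y" using pos_S by eventually_elim simp
    show "continuous_on UNIV K"
      unfolding K_def H_def
      by (intro continuous_intros continuous_on_compose2[OF cont]) auto
    show "\<bar>K x\<bar> \<le> B" for x using B[of "max 0 x"] H0 by (simp add: K_def)
    show "K x = (\<integral>y. K (x + y) \<partial>S)" if "0 \<le> x" for x
    proof -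
      have "(\<integral>y. K (x + y) \<partial>S) = (\<integral>y. H (x + y) \<partial>S)"
      proof (rule integral_cong_AE)
        show "AE y in S. K (x + y) = H (x + y)"
          using pos_S by eventually_elim (use that in \<open>simp add: K_def\<close>)
      qed (auto simp: K_def sets_S)
      then show ?thesis using harmonic[OF that] that by (simp add: K_def)
    qed
  qed (use that atomless_S in auto)
  have "G x = exp (- (\<alpha> * x))" if "0 \<le> x" for x
  proof -
    have "exp (\<alpha> * x) * G x = 1"
      using K_eq[OF that] that range by (simp add: K_def H_def)
    then show ?thesis by (simp add: exp_minus field_simps)
  qed
  then show thesis using that \<alpha>(1) by blast
qed

section \<open>Order statistics of a finite sample\<close>

lemma order_stat_permutation:
  "\<exists>q. bij_betw q {1..k} {1..k} \<and> (\<forall>j\<in>{1..k}. order_stat X k j \<omega> = X (q j) \<omega>)"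
proof -
  define xs where "xs = map (\<lambda>i. X i \<omega>) [1..<Suc k]"
  have len: "length xs = k" by (simp add: xs_def)
  obtain f where f: "bij_betw f {..<k} {..<k}" "\<And>m. m < k \<Longrightarrow> sort xs ! m = xs ! f m"
    using permutation_Ex_bij[of "sort xs" xs] len by auto
  have Suc_bij: "bij_betw Suc {..<k} {1..k}"
    by (simp add: bij_betw_def image_Suc_lessThan)
  have pred_bij: "bij_betw (\<lambda>j. j - 1) {1..k} {..<k}"
    by (rule bij_betw_byWitness[where f' = Suc]) auto
  show ?thesis
  proof (intro exI[of _ "\<lambda>j. Suc (f (j - 1))"] conjI ballI)
    show "bij_betw (\<lambda>j. Suc (f (j - 1))) {1..k} {1..k}"
      using bij_betw_trans[OF bij_betw_trans[OF pred_bij f(1)] Suc_bij] by (simp add: comp_def)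
    show "order_stat X k j \<omega> = X (Suc (f (j - 1))) \<omega>" if "j \<in> {1..k}" for j
    proof -
      have "j - 1 < k" using that by auto
      then have "f (j - 1) < k" using f(1) by (auto simp: bij_betw_def)
      then show ?thesis
        using f(2)[OF \<open>j - 1 < k\<close>]
        by (simp add: order_stat_def xs_def nth_append del: upt_Suc)
    qed
  qed
qed

lemma order_stat_mono:
  assumes "1 \<le> i" "i \<le> j" "j \<le> k"
  shows "order_stat X k i \<omega> \<le> order_stat X k j \<omega>"
  unfolding order_stat_def using assms by (intro sorted_nth_mono) (auto simp del: upt_Suc)

text \<open>Counting replaces the sorted list by a sum of indicators, the source of measurability below.\<close>

lemma order_stat_le_iff:
  assumes "1 \<le> j" "j \<le> k"
  shows "order_stat X k j \<omega> \<le> a \<longleftrightarrow> j \<le> card {i \<in> {1..k}. X i \<omega> \<le> a}"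
proof -
  obtain q where
      "bij_betw q {1..k} {1..k} \<and> (\<forall>j\<in>{1..k}. order_stat X k j \<omega> = X (q j) \<omega>)"
    using order_stat_permutation ..
  note q = conjunct1[OF this] bspec[OF conjunct2[OF this]]
  define A where "A = {m \<in> {1..k}. order_stat X k m \<omega> \<le> a}"
  have "bij_betw q A {i \<in> {1..k}. X i \<omega> \<le> a}"
    unfolding A_def by (rule bij_betw_Collect[OF q(1)]) (use q(2) in auto)
  then have card: "card {i \<in> {1..k}. X i \<omega> \<le> a} = card A"
    using bij_betw_same_card by metis
  show ?thesis
  proof
    assume "order_stat X k j \<omega> \<le> a"
    then have "{1..j} \<subseteq> A"
      using assms order_stat_mono[of _ j k X \<omega>] by (auto simp: A_def intro: order_trans[of _ "order_stat X k j \<omega>"])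
    then show "j \<le> card {i \<in> {1..k}. X i \<omega> \<le> a}"
      unfolding card using card_mono[of A "{1..j}"] by (simp add: A_def)
  next
    assume *: "j \<le> card {i \<in> {1..k}. X i \<omega> \<le> a}"
    show "order_stat X k j \<omega> \<le> a"
    proof (rule ccontr)
      assume "\<not> order_stat X k j \<omega> \<le> a"
      moreover have "order_stat X k j \<omega> \<le> order_stat X k m \<omega>" if "j \<le> m" "m \<in> A" for m
        using that assms by (intro order_stat_mono) (auto simp: A_def)
      ultimately have "A \<subseteq> {1..<j}"
        unfolding A_def by (auto simp: not_le[symmetric]) (meson order_trans)
      then have "card A \<le> j - 1" using card_mono[of "{1..<j}" A] by simp
      then show False using * assms unfolding card by simp
    qed
  qed
qed

lemma borel_measurable_order_stat:
  assumes [measurable]: "\<And>i. i \<in> {1..k} \<Longrightarrow> X i \<in> borel_measurable M"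
    and "1 \<le> j" "j \<le> k"
  shows "order_stat X k j \<in> borel_measurable M"
proof (rule borel_measurable_iff_le[THEN iffD2], rule allI)
  fix a
  have card: "card {i \<in> {1..k}. X i \<omega> \<le> a} = (\<Sum>i\<in>{1..k}. if X i \<omega> \<le> a then 1 else 0)" for \<omega>
    by (simp add: sum.If_cases Int_def)
  have "{\<omega> \<in> space M. order_stat X k j \<omega> \<le> a} =
      {\<omega> \<in> space M. j \<le> (\<Sum>i\<in>{1..k}. if X i \<omega> \<le> a then 1 else 0)}"
    unfolding order_stat_le_iff[OF assms(2,3)] card ..
  also have "\<dots> \<in> sets M" by measurable
  finally show "{\<omega> \<in> space M. order_stat X k j \<omega> \<le> a} \<in> sets M" .
qed

text \<open>The purpose of this form is independence: for \<open>r \<ge> 1\<close> the index \<open>i\<close> on the right is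
unique, so the event splits into \<open>k\<close> disjoint ones, each of which compares one observation with the
maximum of the others.\<close>

lemma top_ratio_greater_iff:
  assumes "2 \<le> k" and pos: "\<And>i. i \<in> {1..k} \<Longrightarrow> 0 < X i \<omega>" and "1 \<le> r"
  shows "r < order_stat X k k \<omega> / order_stat X k (k - 1) \<omega> \<longleftrightarrow>
    (\<exists>i\<in>{1..k}. \<forall>j\<in>{1..k} - {i}. r * X j \<omega> < X i \<omega>)"
proof -
  obtain q where
      "bij_betw q {1..k} {1..k} \<and> (\<forall>j\<in>{1..k}. order_stat X k j \<omega> = X (q j) \<omega>)"
    using order_stat_permutation ..
  note q = conjunct1[OF this] bspec[OF conjunct2[OF this]]
  have q_in: "q j \<in> {1..k}" if "j \<in> {1..k}" for j
    using bij_betwE[OF q(1)] that by blast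
  have q_inj: "q i \<noteq> q j" if "i \<in> {1..k}" "j \<in> {1..k}" "i \<noteq> j" for i j
    using inj_on_eq_iff[OF bij_betw_imp_inj_on[OF q(1)]] that by blast
  have q_surj: "\<exists>m\<in>{1..k}. i = q m" if "i \<in> {1..k}" for i
    using bij_betw_imp_surj_on[OF q(1)] that by blast
  have ks: "k \<in> {1..k}" "k - 1 \<in> {1..k}" "k - 1 \<noteq> k" using assms(1) by auto
  have scaled: "X i \<omega> \<le> r * X i \<omega>" if "i \<in> {1..k}" for i
    using pos[OF that] \<open>1 \<le> r\<close> by simp
  have top: "order_stat X k k \<omega> = X (q k) \<omega>" "order_stat X k (k - 1) \<omega> = X (q (k - 1)) \<omega>"
    using q(2) ks by blast+
  have "0 < order_stat X k (k - 1) \<omega>" unfolding top using pos q_in ks by blast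
  then have "r < order_stat X k k \<omega> / order_stat X k (k - 1) \<omega> \<longleftrightarrow>
      r * X (q (k - 1)) \<omega> < X (q k) \<omega>"
    unfolding top by (rule pos_less_divide_eq)
  also have "\<dots> \<longleftrightarrow> (\<exists>i\<in>{1..k}. \<forall>j\<in>{1..k} - {i}. r * X j \<omega> < X i \<omega>)"
  proof
    assume *: "r * X (q (k - 1)) \<omega> < X (q k) \<omega>"
    have "r * X j \<omega> < X (q k) \<omega>" if j: "j \<in> {1..k} - {q k}" for j
    proof -
      obtain m where m: "m \<in> {1..k}" "j = q m" using q_surj j by blast
      then have "m \<noteq> k" using j by blast
      then have "m \<le> k - 1" using m(1) by auto
      then have "X j \<omega> \<le> X (q (k - 1)) \<omega>"
        using order_stat_mono[of m "k - 1" k X \<omega>] m(1) q(2)[OF m(1)] top(2) by (simp add: m(2))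
      then have "r * X j \<omega> \<le> r * X (q (k - 1)) \<omega>" using \<open>1 \<le> r\<close> by simp
      with * show ?thesis by simp
    qed
    then show "\<exists>i\<in>{1..k}. \<forall>j\<in>{1..k} - {i}. r * X j \<omega> < X i \<omega>" using q_in ks by blast
  next
    assume "\<exists>i\<in>{1..k}. \<forall>j\<in>{1..k} - {i}. r * X j \<omega> < X i \<omega>"
    then obtain i where i: "i \<in> {1..k}" "\<And>j. j \<in> {1..k} - {i} \<Longrightarrow> r * X j \<omega> < X i \<omega>" by blast
    obtain m where m: "m \<in> {1..k}" "i = q m" using q_surj i by blast
    have "m = k"
    proof (rule ccontr)
      assume "m \<noteq> k"
      then have "r * X (q k) \<omega> < X i \<omega>"
        using i(2)[of "q k"] q_in[OF ks(1)] q_inj[OF ks(1) m(1)] m(2) by blast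
      moreover have "X i \<omega> \<le> X (q k) \<omega>"
        using order_stat_mono[of m k k X \<omega>] m(1) q(2)[OF m(1)] top(1) by (simp add: m(2))
      ultimately show False using scaled[OF q_in[OF ks(1)]] by linarith
    qed
    then show "r * X (q (k - 1)) \<omega> < X (q k) \<omega>"
      using i(2)[of "q (k - 1)"] q_in[OF ks(2)] q_inj[OF ks(2) ks(1) ks(3)] m(2) by blast
  qed
  finally show ?thesis .
qed

section \<open>The ratio of the two largest observations\<close>

lemma (in prob_space) indep_vars_Max:
  fixes X :: "'i \<Rightarrow> 'a \<Rightarrow> real"
  assumes I: "finite I" "i \<notin> I" and indep: "indep_vars (\<lambda>_. borel) X (insert i I)"
  shows "indep_var borel (X i) borel (\<lambda>\<omega>. Max ((\<lambda>i. X i \<omega>) ` I))"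
proof -
  have "indep_var
    borel ((\<lambda>f. f i) \<circ> (\<lambda>\<omega>. restrict (\<lambda>i. X i \<omega>) {i}))
    borel ((\<lambda>f. Max (f ` I)) \<circ> (\<lambda>\<omega>. restrict (\<lambda>i. X i \<omega>) I))"
    using I by (intro indep_var_compose[OF indep_var_restrict[OF indep]] borel_measurable_Max) auto
  then show ?thesis by (simp add: comp_def cong: image_cong_simp)
qed

lemma (in prob_space) prob_indep_pair:
  fixes U V :: "'a \<Rightarrow> real"
  assumes indep: "indep_var borel U borel V"
    and A[measurable]: "A \<in> sets (borel \<Otimes>\<^sub>M borel)"
  shows "prob {\<omega> \<in> space M. (U \<omega>, V \<omega>) \<in> A} =
    (\<integral>y. measure (distr M borel U) {x. (x, y) \<in> A} \<partial>distr M borel V)"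
proof -
  have [measurable]: "U \<in> borel_measurable M" "V \<in> borel_measurable M"
    using indep indep_var_rv1 indep_var_rv2 by blast+
  interpret U: prob_space "distr M borel U" by (rule prob_space_distr) simp
  interpret V: prob_space "distr M borel V" by (rule prob_space_distr) simp
  interpret P: pair_prob_space "distr M borel U" "distr M borel V" ..
  have A': "A \<in> sets (distr M borel U \<Otimes>\<^sub>M distr M borel V)" by simp
  have "emeasure M {\<omega> \<in> space M. (U \<omega>, V \<omega>) \<in> A} =
      emeasure (distr M (borel \<Otimes>\<^sub>M borel) (\<lambda>\<omega>. (U \<omega>, V \<omega>))) A"
    by (subst emeasure_distr) (auto intro!: arg_cong[where f = "emeasure M"])
  also have "distr M (borel \<Otimes>\<^sub>M borel) (\<lambda>\<omega>. (U \<omega>, V \<omega>)) = distr M borel U \<Otimes>\<^sub>M distr M borel V"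
    using indep by (simp add: indep_var_distribution_eq)
  also have "emeasure \<dots> A = (\<integral>\<^sup>+y. emeasure (distr M borel U) ((\<lambda>x. (x, y)) -` A) \<partial>distr M borel V)"
    by (rule P.emeasure_pair_measure_alt2[OF A'])
  also have "\<dots> = (\<integral>\<^sup>+y. ennreal (measure (distr M borel U) {x. (x, y) \<in> A}) \<partial>distr M borel V)"
    by (simp add: U.emeasure_eq_measure vimage_def)
  finally have eq: "ennreal (prob {\<omega> \<in> space M. (U \<omega>, V \<omega>) \<in> A}) = \<dots>"
    by (simp add: emeasure_eq_measure)
  have "(\<lambda>y. measure (distr M borel U) ((\<lambda>x. (x, y)) -` A)) \<in> borel_measurable (distr M borel V)"
    unfolding measure_def by (intro borel_measurable_enn2real P.measurable_emeasure_Pair2 A')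
  then have "(\<integral>y. measure (distr M borel U) {x. (x, y) \<in> A} \<partial>distr M borel V) =
      enn2real (\<integral>\<^sup>+y. ennreal (measure (distr M borel U) {x. (x, y) \<in> A}) \<partial>distr M borel V)"
    by (intro integral_eq_nn_integral) (auto simp: vimage_def)
  then show ?thesis by (simp flip: eq)
qed

(* The sample is indexed from 1; the simplifier should leave X 1 in this form. *)
declare One_nat_def [simp del]

locale positive_iid_sample = prob_space M for M :: "'a measure" +
  fixes X :: "nat \<Rightarrow> 'a \<Rightarrow> real" and k :: nat
  assumes k2: "2 \<le> k"
    and indep: "indep_vars (\<lambda>_. borel) X {1..k}"
    and ident: "\<And>i. i \<in> {1..k} \<Longrightarrow> distr M borel (X i) = distr M borel (X 1)"
    and pos: "\<And>i. i \<in> {1..k} \<Longrightarrow> AE \<omega> in M. 0 < X i \<omega>"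
    and atomless: "\<And>a. measure (distr M borel (X 1)) {a} = 0"
begin

abbreviation F :: "real \<Rightarrow> real" where
  "F \<equiv> cdf (distr M borel (X 1))"

abbreviation max_rest :: "nat \<Rightarrow> 'a \<Rightarrow> real" where
  "max_rest i \<equiv> \<lambda>\<omega>. Max ((\<lambda>j. X j \<omega>) ` ({1..k} - {i}))"

abbreviation N :: "real measure" where
  "N \<equiv> distr M borel (max_rest 1)"

abbreviation R :: "'a \<Rightarrow> real" where
  "R \<equiv> \<lambda>\<omega>. order_stat X k k \<omega> / order_stat X k (k - 1) \<omega>"

lemma rv[measurable]: "i \<in> {1..k} \<Longrightarrow> X i \<in> borel_measurable M"
  using indep by (auto simp: indep_vars_def)

lemma rv_max_rest[measurable]: "max_rest i \<in> borel_measurable M"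
  by (rule borel_measurable_Max) auto

lemma rv_R[measurable]: "R \<in> borel_measurable M"
  using k2 by (intro borel_measurable_divide borel_measurable_order_stat rv) auto

lemma real_distribution_X: "real_distribution (distr M borel (X 1))"
  using k2 by (intro real_distribution_distr rv) auto

lemma real_distribution_N: "real_distribution N"
  by (rule real_distribution_distr) measurable

lemma real_distribution_R: "real_distribution (distr M borel R)"
  by (rule real_distribution_distr) measurable

lemma prob_le: "i \<in> {1..k} \<Longrightarrow> prob {\<omega> \<in> space M. X i \<omega> \<le> a} = F a"
  unfolding ident[symmetric] cdf_def
  by (subst measure_distr) (auto intro!: arg_cong[where f = prob])

lemma measure_greater: "measure (distr M borel (X 1)) {a<..} = 1 - F a"
proof -
  interpret D: real_distribution "distr M borel (X 1)" by (rule real_distribution_X)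
  have "{a<..} = UNIV - {..a}" by auto
  then show ?thesis using D.prob_compl[of "{..a}"] by (simp add: cdf_def)
qed

lemma measure_at_least: "measure (distr M borel (X 1)) {a..} = 1 - F a"
proof -
  interpret D: real_distribution "distr M borel (X 1)" by (rule real_distribution_X)
  have "{a..} = {a} \<union> {a<..}" by auto
  then show ?thesis
    using D.finite_measure_Union[of "{a}" "{a<..}"] atomless by (simp add: measure_greater)
qed

lemma continuous_F: "continuous_on UNIV F"
proof -
  interpret D: real_distribution "distr M borel (X 1)" by (rule real_distribution_X)
  show ?thesis using atomless D.isCont_cdf by (intro continuous_at_imp_continuous_on) blast
qed

lemma rest_nonempty: "{1..k} - {i} \<noteq> {}"
proof -
  have "1 \<in> {1..k}" "2 \<in> {1..k}" using k2 by auto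
  then have "1 \<in> {1..k} - {i} \<or> 2 \<in> {1..k} - {i}" by (cases "i = 1") auto
  then show ?thesis by blast
qed

lemma cdf_max_rest:
  assumes "i \<in> {1..k}"
  shows "cdf (distr M borel (max_rest i)) a = F a ^ (k - 1)"
proof -
  have "cdf (distr M borel (max_rest i)) a = prob {\<omega> \<in> space M. max_rest i \<omega> \<le> a}"
    unfolding cdf_def by (subst measure_distr) (auto intro!: arg_cong[where f = prob])
  also have "{\<omega> \<in> space M. max_rest i \<omega> \<le> a} = (\<Inter>j\<in>{1..k} - {i}. X j -` {..a} \<inter> space M)"
    using rest_nonempty[of i] by (subst Max_le_iff) auto
  also have "prob \<dots> = (\<Prod>j\<in>{1..k} - {i}. prob (X j -` {..a} \<inter> space M))"
    using rest_nonempty[of i] by (intro indep_varsD[OF indep]) auto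
  also have "\<dots> = (\<Prod>j\<in>{1..k} - {i}. F a)"
    using prob_le by (intro prod.cong) (auto simp: vimage_def Int_def conj_commute)
  also have "\<dots> = F a ^ (k - 1)" using assms by simp
  finally show ?thesis .
qed

text \<open>By exchangeability the law of the maximum of the other observations is the same for each
omitted index; this common law is \<open>N\<close>.\<close>

lemma distr_max_rest: "i \<in> {1..k} \<Longrightarrow> distr M borel (max_rest i) = N"
  using k2 by (intro cdf_unique real_distribution_distr ext) (auto simp: cdf_max_rest)

lemma AE_N_greater:
  assumes "F a = 0"
  shows "AE y in N. a < y"
proof -
  interpret N: real_distribution N by (rule real_distribution_N)
  have "N.prob {..a} = 0" using cdf_max_rest[of 1 a] assms k2 by (simp add: cdf_def)
  then have "AE y in N. y \<notin> {..a}"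
    by (intro AE_not_in) (auto simp: null_sets_def N.emeasure_eq_measure)
  then show ?thesis by eventually_elim auto
qed

lemma atomless_N: "measure N {a} = 0"
proof -
  interpret N: real_distribution N by (rule real_distribution_N)
  have "cdf N = (\<lambda>a. F a ^ (k - 1))"
    by (rule ext, rule cdf_max_rest) (use k2 in auto)
  then have "continuous_on UNIV (cdf N)"
    using continuous_on_power[OF continuous_F] by simp
  then show ?thesis using N.isCont_cdf continuous_on_eq_continuous_at by blast
qed

lemma indep_max_rest: "i \<in> {1..k} \<Longrightarrow> indep_var borel (X i) borel (max_rest i)"
  using indep by (intro indep_vars_Max) (auto simp: insert_absorb)

lemma prob_exceeds_rest:
  assumes "i \<in> {1..k}"
  shows "prob {\<omega> \<in> space M. r * max_rest i \<omega> < X i \<omega>} = (\<integral>y. 1 - F (r * y) \<partial>N)"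
proof -
  have "{p \<in> space (borel \<Otimes>\<^sub>M borel). r * snd p < fst p} \<in> sets (borel \<Otimes>\<^sub>M (borel :: real measure))"
    by measurable
  then have meas: "{p. r * snd p < fst p} \<in> sets (borel \<Otimes>\<^sub>M (borel :: real measure))"
    by (simp add: space_pair_measure)
  have "prob {\<omega> \<in> space M. (X i \<omega>, max_rest i \<omega>) \<in> {p. r * snd p < fst p}} =
      (\<integral>y. measure (distr M borel (X i)) {x. (x, y) \<in> {p. r * snd p < fst p}} \<partial>distr M borel (max_rest i))"
    by (rule prob_indep_pair[OF indep_max_rest[OF assms] meas])
  moreover have "{x. r * y < x} = {r * y<..}" for y by auto
  ultimately show ?thesis
    by (simp add: ident[OF assms] distr_max_rest[OF assms] measure_greater)
qed

lemma prob_at_least_rest: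
  assumes "i \<in> {1..k}"
  shows "prob {\<omega> \<in> space M. max_rest i \<omega> \<le> X i \<omega>} = (\<integral>y. 1 - F y \<partial>N)"
proof -
  have "{p \<in> space (borel \<Otimes>\<^sub>M borel). snd p \<le> fst p} \<in> sets (borel \<Otimes>\<^sub>M (borel :: real measure))"
    by measurable
  then have meas: "{p. snd p \<le> fst p} \<in> sets (borel \<Otimes>\<^sub>M (borel :: real measure))"
    by (simp add: space_pair_measure)
  have "prob {\<omega> \<in> space M. (X i \<omega>, max_rest i \<omega>) \<in> {p. snd p \<le> fst p}} =
      (\<integral>y. measure (distr M borel (X i)) {x. (x, y) \<in> {p. snd p \<le> fst p}} \<partial>distr M borel (max_rest i))"
    by (rule prob_indep_pair[OF indep_max_rest[OF assms] meas])
  moreover have "{x. y \<le> x} = {y..}" for y :: real by auto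
  ultimately show ?thesis
    by (simp add: ident[OF assms] distr_max_rest[OF assms] measure_at_least)
qed

lemma AE_all_pos: "AE \<omega> in M. \<forall>i\<in>{1..k}. 0 < X i \<omega>"
  using pos by (intro AE_finite_allI) auto

text \<open>By symmetry each of the \<open>k\<close> disjoint events of \<open>top_ratio_greater_iff\<close> has the same
probability. Conditioning on the maximum of the others expresses it through the tail \<open>1 - F\<close>.\<close>

lemma cdf_R:
  assumes "1 \<le> r"
  shows "cdf (distr M borel R) r = 1 - k * (\<integral>y. 1 - F (r * y) \<partial>N)"
proof -
  define A where "A i = {\<omega> \<in> space M. (\<forall>j\<in>{1..k}. 0 < X j \<omega>) \<and> r * max_rest i \<omega> < X i \<omega>}" for i
  have A_iff: "\<omega> \<in> A i \<longleftrightarrow> \<omega> \<in> space M \<and> (\<forall>j\<in>{1..k}. 0 < X j \<omega>) \<and>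
      (\<forall>j\<in>{1..k} - {i}. r * X j \<omega> < X i \<omega>)" for i \<omega>
  proof -
    have "r * max_rest i \<omega> < X i \<omega> \<longleftrightarrow> max_rest i \<omega> < X i \<omega> / r"
      using assms by (simp add: field_simps)
    also have "\<dots> \<longleftrightarrow> (\<forall>j\<in>{1..k} - {i}. X j \<omega> < X i \<omega> / r)"
      using rest_nonempty[of i] by (subst Max_less_iff) auto
    also have "\<dots> \<longleftrightarrow> (\<forall>j\<in>{1..k} - {i}. r * X j \<omega> < X i \<omega>)"
      using assms by (simp add: field_simps)
    finally show ?thesis by (auto simp: A_def)
  qed
  have A_meas: "A i \<in> events" if "i \<in> {1..k}" for i
    unfolding A_def using that by measurable
  have "prob {\<omega> \<in> space M. r < R \<omega>} = prob (\<Union>i\<in>{1..k}. A i)"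
  proof (rule finite_measure_eq_AE)
    show "AE \<omega> in M. \<omega> \<in> {\<omega> \<in> space M. r < R \<omega>} \<longleftrightarrow> \<omega> \<in> (\<Union>i\<in>{1..k}. A i)"
      using AE_all_pos AE_space
    proof eventually_elim
      case (elim \<omega>)
      then show ?case
        using top_ratio_greater_iff[of k X \<omega> r] k2 assms by (auto simp: A_iff)
    qed
  qed (use A_meas in auto)
  also have "\<dots> = (\<Sum>i\<in>{1..k}. prob (A i))"
  proof (rule finite_measure_finite_Union)
    show "disjoint_family_on A {1..k}"
      unfolding disjoint_family_on_def
    proof (intro ballI impI, rule ccontr)
      fix i j assume ij: "i \<in> {1..k}" "j \<in> {1..k}" "i \<noteq> j" "A i \<inter> A j \<noteq> {}"
      then obtain \<omega> where "\<omega> \<in> A i" "\<omega> \<in> A j" by blast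
      with ij have "0 < X i \<omega>" "0 < X j \<omega>" "r * X j \<omega> < X i \<omega>" "r * X i \<omega> < X j \<omega>"
        by (auto simp: A_iff)
      moreover have "X i \<omega> \<le> r * X i \<omega>" "X j \<omega> \<le> r * X j \<omega>"
        using calculation assms by simp_all
      ultimately show False by linarith
    qed
  qed (use A_meas in auto)
  also have "\<dots> = (\<Sum>i\<in>{1..k}. \<integral>y. 1 - F (r * y) \<partial>N)"
  proof (rule sum.cong[OF refl])
    fix i assume i: "i \<in> {1..k}"
    have "prob (A i) = prob {\<omega> \<in> space M. r * max_rest i \<omega> < X i \<omega>}"
    proof (rule finite_measure_eq_AE)
      show "AE \<omega> in M. \<omega> \<in> A i \<longleftrightarrow> \<omega> \<in> {\<omega> \<in> space M. r * max_rest i \<omega> < X i \<omega>}"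
        using AE_all_pos by eventually_elim (simp add: A_def)
    qed (use A_meas i in auto)
    then show "prob (A i) = (\<integral>y. 1 - F (r * y) \<partial>N)" using prob_exceeds_rest[OF i] by simp
  qed
  also have "\<dots> = k * (\<integral>y. 1 - F (r * y) \<partial>N)" by simp
  finally have "prob {\<omega> \<in> space M. r < R \<omega>} = k * (\<integral>y. 1 - F (r * y) \<partial>N)" .
  moreover have "cdf (distr M borel R) r = prob {\<omega> \<in> space M. R \<omega> \<le> r}"
    unfolding cdf_def by (subst measure_distr) (auto intro!: arg_cong[where f = prob])
  moreover have "prob {\<omega> \<in> space M. R \<omega> \<le> r} = 1 - prob {\<omega> \<in> space M. r < R \<omega>}"
    by (subst prob_neg[symmetric]) (auto simp: not_less)
  ultimately show ?thesis by simp
qed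

lemma R_ge_1: "AE \<omega> in M. 1 \<le> R \<omega>"
  using AE_all_pos
proof eventually_elim
  case (elim \<omega>)
  obtain q where
      "bij_betw q {1..k} {1..k} \<and> (\<forall>j\<in>{1..k}. order_stat X k j \<omega> = X (q j) \<omega>)"
    using order_stat_permutation ..
  note q = conjunct1[OF this] bspec[OF conjunct2[OF this]]
  have "k - 1 \<in> {1..k}" using k2 by auto
  then have "0 < order_stat X k (k - 1) \<omega>" using elim q(2) bij_betwE[OF q(1)] by metis
  moreover have "order_stat X k (k - 1) \<omega> \<le> order_stat X k k \<omega>"
    using k2 by (intro order_stat_mono) auto
  ultimately show ?case by simp
qed

lemma cdf_R_below_1:
  assumes "r < 1"
  shows "cdf (distr M borel R) r = 0"
proof -
  have "cdf (distr M borel R) r = prob {\<omega> \<in> space M. R \<omega> \<le> r}"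
    unfolding cdf_def by (subst measure_distr) (auto intro!: arg_cong[where f = prob])
  also have "\<dots> = 0"
    using R_ge_1 assms by (subst prob_eq_0) (auto elim!: eventually_mono)
  finally show ?thesis .
qed

text \<open>Some observation is always maximal, so the probabilities that the \<open>i\<close>-th one is at least the others
sum to at least \<open>1\<close>. As ties have probability \<open>0\<close>, strict and weak inequality are equally likely.\<close>

lemma total_mass: "k * (\<integral>y. 1 - F y \<partial>N) = 1"
proof (rule antisym)
  interpret R: real_distribution "distr M borel R" by (rule real_distribution_R)
  show "k * (\<integral>y. 1 - F y \<partial>N) \<le> 1"
    using cdf_R[of 1] R.cdf_nonneg[of 1] by simp
  define B where "B i = {\<omega> \<in> space M. max_rest i \<omega> \<le> X i \<omega>}" for i
  have B_meas: "B ` {1..k} \<subseteq> events"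
    unfolding B_def by (intro image_subsetI) measurable
  have "\<exists>i\<in>{1..k}. max_rest i \<omega> \<le> X i \<omega>" for \<omega>
  proof -
    obtain i where i: "i \<in> {1..k}" "Max ((\<lambda>j. X j \<omega>) ` {1..k}) = X i \<omega>"
    proof -
      have "Max ((\<lambda>j. X j \<omega>) ` {1..k}) \<in> (\<lambda>j. X j \<omega>) ` {1..k}"
        using k2 by (intro Max_in) auto
      then show thesis using that by blast
    qed
    then have "X j \<omega> \<le> X i \<omega>" if "j \<in> {1..k}" for j
      using Max_ge[of "(\<lambda>j. X j \<omega>) ` {1..k}" "X j \<omega>"] that by auto
    then have "max_rest i \<omega> \<le> X i \<omega>" using rest_nonempty[of i] by (subst Max_le_iff) auto
    then show ?thesis using i by blast
  qed
  then have "space M = (\<Union>i\<in>{1..k}. B i)" by (auto simp: B_def)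
  then have "1 \<le> (\<Sum>i\<in>{1..k}. prob (B i))"
    using finite_measure_subadditive_finite[OF _ B_meas] prob_space by simp
  also have "\<dots> = (\<Sum>i\<in>{1..k}. \<integral>y. 1 - F y \<partial>N)"
    unfolding B_def by (intro sum.cong refl prob_at_least_rest)
  finally show "1 \<le> k * (\<integral>y. 1 - F y \<partial>N)" by simp
qed

section \<open>Characterization of the Pareto family\<close>

text \<open>Equality in law makes \<open>cdf_R\<close> an equation for \<open>F\<close> alone, and it confines the sample to
\<open>[1, \<infinity>)\<close> because the ratio lives there. On the logarithmic scale the equation is the
integrated Cauchy equation for the tail, with steps distributed as the logarithm of the maximum
of the other observations.\<close>

lemma pareto_if_ratio_equidistributed:
  assumes eq: "distr M borel (X 1) = distr M borel R"
  shows "F \<in> pareto_family"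
proof -
  interpret N: real_distribution N by (rule real_distribution_N)
  have F_below: "F r = 0" if "r < 1" for r
    unfolding eq using that by (rule cdf_R_below_1)
  have F_above: "1 - F r = k * (\<integral>y. 1 - F (r * y) \<partial>N)" if "1 \<le> r" for r
    using cdf_R[OF that] eq by simp
  have "F 1 = 0" using F_above[of 1] total_mass by simp
  then have N_gt: "AE y in N. 1 < y" by (rule AE_N_greater)
  interpret D: real_distribution "distr M borel (X 1)" by (rule real_distribution_X)
  have F_mono: "F a \<le> F b" if "a \<le> b" for a b using D.cdf_nondecreasing that by simp
  have [measurable]: "F \<in> borel_measurable borel"
    by (rule borel_measurable_continuous_onI[OF continuous_F])
  define G where "G x = 1 - F (exp x)" for x
  define L where "L = distr N borel ln"
  interpret L: prob_space L unfolding L_def by (rule N.prob_space_distr) simp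
  have contG: "continuous_on UNIV G"
    unfolding G_def by (intro continuous_intros continuous_on_compose2[OF continuous_F]) auto
  have [measurable]: "G \<in> borel_measurable borel"
    by (rule borel_measurable_continuous_onI[OF contG])
  obtain \<alpha> where \<alpha>: "0 < \<alpha>" "\<And>x. 0 \<le> x \<Longrightarrow> G x = exp (- (\<alpha> * x))"
  proof (rule integrated_Cauchy_equation[of L "real k" G])
    show "prob_space L" by (rule L.prob_space_axioms)
    show "sets L = sets borel" by (simp add: L_def)
    show "AE y in L. 0 < y"
      unfolding L_def using N_gt by (subst AE_distr_iff) auto
    show "measure L {a} = 0" for a
    proof -
      have "measure L {a} = measure N (ln -` {a})"
        unfolding L_def by (subst measure_distr) auto
      also have "\<dots> = measure N {exp a}"
      proof (rule N.finite_measure_eq_AE)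
        show "AE y in N. y \<in> ln -` {a} \<longleftrightarrow> y \<in> {exp a}"
          using N_gt by eventually_elim auto
      qed (use measurable_sets[of ln borel borel "{a}"] in auto)
      finally show ?thesis by (simp add: atomless_N)
    qed
    show "1 < real k" using k2 by simp
    show "continuous_on UNIV G" by (rule contG)
    show "antimono G" using F_mono by (auto intro!: antimonoI simp: G_def)
    show "0 \<le> G x" "G x \<le> 1" for x
      using D.cdf_bounded_prob D.cdf_nonneg by (simp_all add: G_def)
    show "G 0 = 1" using \<open>F 1 = 0\<close> by (simp add: G_def)
    show "G x = k * (\<integral>y. G (x + y) \<partial>L)" if "0 \<le> x" for x
    proof -
      have "(\<integral>y. G (x + y) \<partial>L) = (\<integral>y. G (x + ln y) \<partial>N)"
        unfolding L_def by (rule integral_distr) auto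
      also have "\<dots> = (\<integral>y. 1 - F (exp x * y) \<partial>N)"
      proof (rule integral_cong_AE)
        show "AE y in N. G (x + ln y) = 1 - F (exp x * y)"
          using N_gt by eventually_elim (simp add: G_def exp_add)
      qed auto
      finally show ?thesis using F_above[of "exp x"] that by (simp add: G_def)
    qed
  qed blast
  have "F x = pareto_cdf \<alpha> x" for x
  proof (cases "1 \<le> x")
    case True
    then have "G (ln x) = x powr (- \<alpha>)" using \<alpha>(2)[of "ln x"] by (simp add: powr_def)
    then show ?thesis using True by (simp add: G_def pareto_cdf_def)
  qed (simp add: F_below pareto_cdf_def)
  then show ?thesis using \<alpha>(1) by (auto simp: pareto_family_def)
qed

text \<open>The Pareto tail is multiplicative on \<open>[1, \<infinity>)\<close>, so the factor \<open>r powr (- l)\<close> leaves the integral in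
\<open>cdf_R\<close>, and \<open>total_mass\<close> evaluates what remains.\<close>

lemma ratio_equidistributed_if_pareto:
  assumes "F \<in> pareto_family"
  shows "distr M borel (X 1) = distr M borel R"
proof (rule cdf_unique[OF real_distribution_X real_distribution_R], rule ext)
  obtain l where l: "0 < l" "F = pareto_cdf l" using assms by (auto simp: pareto_family_def)
  interpret N: real_distribution N by (rule real_distribution_N)
  have [measurable]: "F \<in> borel_measurable borel"
    by (rule borel_measurable_continuous_onI[OF continuous_F])
  have N_gt: "AE y in N. 1 < y" 
    by (rule AE_N_greater) (unfold l(2) pareto_cdf_def, simp)
  fix r
  show "F r = cdf (distr M borel R) r"
  proof (cases "1 \<le> r")
    case True
    have "(\<integral>y. 1 - F (r * y) \<partial>N) = (\<integral>y. r powr (- l) * (1 - F y) \<partial>N)"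
    proof (rule integral_cong_AE)
      show "AE y in N. 1 - F (r * y) = r powr (- l) * (1 - F y)"
        using N_gt
      proof eventually_elim
        case (elim y)
        then have "1 \<le> r * y" using True mult_mono[of 1 r 1 y] by simp
        then show ?case using elim True by (simp add: l(2) pareto_cdf_def powr_mult)
      qed
    qed auto
    then have "k * (\<integral>y. 1 - F (r * y) \<partial>N) = r powr (- l) * (k * (\<integral>y. 1 - F y \<partial>N))"
      by simp
    then show ?thesis
      unfolding cdf_R[OF True] total_mass using True by (simp add: l(2) pareto_cdf_def)
  qed (simp add: cdf_R_below_1 l(2) pareto_cdf_def)
qed

end

theorem theorem1:
  fixes M :: "'a measure" and X :: "nat \<Rightarrow> 'a \<Rightarrow> real" and k :: nat
  assumes "prob_space M" and "k \<ge> 2"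
    and indep: "prob_space.indep_vars M (\<lambda>_. borel) X {1..k}"
    and ident: "\<And>i. i \<in> {1..k} \<Longrightarrow> distr M borel (X i) = distr M borel (X 1)"
    and pos: "\<And>i. i \<in> {1..k} \<Longrightarrow> AE \<omega> in M. 0 < X i \<omega>"
    and bdd: "\<And>i. i \<in> {1..k} \<Longrightarrow> bounded_rv M (X i)"
    and ac: "absolutely_continuous lborel (distr M borel (X 1))"
    and cls: "cdf (distr M borel (X 1)) \<in> mult_class"
  shows "distr M borel (X 1) =
           distr M borel (\<lambda>\<omega>. order_stat X k k \<omega> / order_stat X k (k - 1) \<omega>)
         \<longleftrightarrow> cdf (distr M borel (X 1)) \<in> pareto_family"
proof -
  have atomless: "measure (distr M borel (X 1)) {a} = 0" for a
  proof -
    have "{a} \<in> null_sets lborel" by (simp add: null_sets_def)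
    then have "{a} \<in> null_sets (distr M borel (X 1))"
      using ac by (auto simp: absolutely_continuous_def)
    then show ?thesis by (simp add: measure_def null_sets_def)
  qed
  interpret positive_iid_sample M X k
    by (intro positive_iid_sample.intro positive_iid_sample_axioms.intro) fact+
  show ?thesis
    using pareto_if_ratio_equidistributed ratio_equidistributed_if_pareto by blast
qed

end
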